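(* Let $n,m\ge 1$ be integers, let $P\in\mathbb{R}^{n\times n}$ be an orthogonal projection matrix with $\nu:=\mathrm{Tr}(I-P)\ge 1$, let $C\in\mathbb{R}^{m\times n}$ satisfy $CP=C$, let $b\in\mathbb{R}^m$, and let $\mu\in\mathbb{R}^n$ satisfy $P\mu=\mu$ and $\sigma^2>0$. Let $\eta\in\mathbb{R}^n$ satisfy $P\eta=\eta$ and $\|\eta\|_2=1$, and let $\theta\in\mathbb{R}$ be such that $\eta^T\mu=\theta$. Suppose $y\sim\mathbb{M}_{(C,b,P)}$, i.e. $y$ has the law of a $N(\mu,\sigma^2 I)$ vector conditioned on the event $\{Cy\le \hat\sigma_P(y)\,b\}$ (assumed to have positive probability), where $\hat\sigma_P^2(y)=\|(I-P)y\|_2^2/\mathrm{Tr}(I-P)$. Then the conditional law of $$\tau_\theta(y)=\frac{\eta^Ty-\theta}{\hat\sigma_P(y)}$$ given $(P-\eta\eta^T)(y-\theta\eta)$ and $\|y-\theta\eta\|_2^2$ is the truncated Student law $T_{\nu|\Omega}$, with truncation set $$\Omega=\Omega\big(C,b,P,\ \|(I-P)y\|_2^2+(\eta^Ty-\theta)^2,\ (P-\eta\eta^T)y,\ \theta\big),$$ where, for $w>0$ and $v\in\mathbb{R}^n$, $$\Omega(C,b,P,w,v,\theta)=\bigcap_{i=1}^{m}\Big\{t\in\mathbb{R}:\ t\sqrt{w}\,(C\eta)_i+\big(C(\theta\eta+v)\big)_i\sqrt{\nu+t^2}\le \sqrt{w}\,b_i\Big\}.$$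
   Context: Vector inequalities are understood coordinatewise. For $\nu\geq 1$ and a measurable set $\Omega\subset\mathbb{R}$, $T_{\nu|\Omega}$ denotes the law of $T_\nu$ conditioned on $T_\nu\in\Omega$, where $T_\nu$ has Student's $t$ distribution with $\nu$ degrees of freedom; i.e. its distribution function is $T_{\nu|\Omega}(t)=\mathbb{P}(T_\nu\le t\mid T_\nu\in\Omega)$. Note that $\Omega$ in the claim is a function of the conditioning statistics, since $(P-\eta\eta^T)\eta=0$ and $\|(I-P)y\|_2^2+(\eta^Ty-\theta)^2=\|y-\theta\eta\|_2^2-\|(P-\eta\eta^T)y\|_2^2$. *)

theory Defs
  imports "HOL-Probability.Probability"
begin

definition orthogonal_projection_matrix :: "real^'n^'n \<Rightarrow> bool" where
  "orthogonal_projection_matrix P \<longleftrightarrow> P ** P = P \<and> transpose P = P"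

definition outer_product :: "real^'m \<Rightarrow> real^'n \<Rightarrow> real^'n^'m" where
  "outer_product u v = (\<chi> i j. u $ i * v $ j)"

definition resid_df :: "real^'n^'n \<Rightarrow> real" where
  "resid_df P = trace (mat 1 - P)"

definition sigma_hat :: "real^'n^'n \<Rightarrow> real^'n \<Rightarrow> real" where
  "sigma_hat P y = sqrt ((norm ((mat 1 - P) *v y))\<^sup>2 / resid_df P)"

text \<open>The law \<open>N(\<mu>, \<sigma>\<^sup>2 I)\<close>; as in \<^const>\<open>normal_density\<close>, \<open>\<sigma>\<close> is the standard deviation.\<close>

definition isotropic_normal :: "real^'n \<Rightarrow> real \<Rightarrow> (real^'n) measure" where
  "isotropic_normal \<mu> \<sigma> =
     density lborel (\<lambda>x. ennreal (\<Prod>i\<in>UNIV. normal_density (\<mu> $ i) \<sigma> (x $ i)))"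

text \<open>The order on \<^typ>\<open>real^'m\<close> is the coordinatewise one.\<close>

definition selection_event :: "real^'n^'m \<Rightarrow> real^'m \<Rightarrow> real^'n^'n \<Rightarrow> (real^'n) set" where
  "selection_event C b P = {y. C *v y \<le> sigma_hat P y *\<^sub>R b}"

text \<open>For an event \<open>A\<close> of positive probability under a probability measure \<open>M\<close>,
  \<open>uniform_measure M A\<close> is \<open>M\<close> conditioned on \<open>A\<close>.\<close>

definition selected_normal ::
  "real^'n^'m \<Rightarrow> real^'m \<Rightarrow> real^'n^'n \<Rightarrow> real^'n \<Rightarrow> real \<Rightarrow> (real^'n) measure" where
  "selected_normal C b P \<mu> \<sigma> = uniform_measure (isotropic_normal \<mu> \<sigma>) (selection_event C b P)"

definition student_density :: "real \<Rightarrow> real \<Rightarrow> real" where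
  "student_density \<nu> t =
     Gamma ((\<nu> + 1) / 2) / (sqrt (\<nu> * pi) * Gamma (\<nu> / 2)) * (1 + t\<^sup>2 / \<nu>) powr (- ((\<nu> + 1) / 2))"

definition student_law :: "real \<Rightarrow> real measure" where
  "student_law \<nu> = density lborel (\<lambda>t. ennreal (student_density \<nu> t))"

text \<open>If \<open>\<Omega>\<close> is a null set, this is the zero measure rather than a probability measure.\<close>

definition truncated_student_law :: "real \<Rightarrow> real set \<Rightarrow> real measure" where
  "truncated_student_law \<nu> \<Omega> = uniform_measure (student_law \<nu>) \<Omega>"

definition truncation_set ::
  "real^'n \<Rightarrow> real^'n^'m \<Rightarrow> real^'m \<Rightarrow> real^'n^'n \<Rightarrow> real \<Rightarrow> real^'n \<Rightarrow> real \<Rightarrow> real set" where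
  "truncation_set \<eta> C b P w v \<theta> =
     (\<Inter>i. {t. t * sqrt w * (C *v \<eta>) $ i
                + (C *v (\<theta> *\<^sub>R \<eta> + v)) $ i * sqrt (resid_df P + t\<^sup>2) \<le> sqrt w * b $ i})"

definition tau_stat :: "real^'n^'n \<Rightarrow> real^'n \<Rightarrow> real \<Rightarrow> real^'n \<Rightarrow> real" where
  "tau_stat P \<eta> \<theta> y = (\<eta> \<bullet> y - \<theta>) / sigma_hat P y"

text \<open>\<open>K\<close> is a regular conditional distribution under \<open>M\<close> of the real random variable \<open>X\<close> given
  the random element \<open>S\<close>, i.e. given the sigma-algebra generated by \<open>S\<close>. The kernel \<open>K\<close> is indexed
  by sample points and required to be measurable with respect to that sigma-algebra. It may fail to
  be a probability measure on a null set of sample points only.\<close>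

definition is_conditional_law ::
  "'a measure \<Rightarrow> ('a \<Rightarrow> real) \<Rightarrow> ('a \<Rightarrow> 'b::topological_space) \<Rightarrow> ('a \<Rightarrow> real measure) \<Rightarrow> bool" where
  "is_conditional_law M X S K \<longleftrightarrow>
     (let F = vimage_algebra (space M) S borel in
        X \<in> borel_measurable M \<and> S \<in> borel_measurable M \<and>
        K \<in> F \<rightarrow>\<^sub>M subprob_algebra borel \<and>
        (AE \<omega> in M. prob_space (K \<omega>)) \<and>
        (\<forall>B\<in>sets borel. AE \<omega> in M.
           real_cond_exp M F (indicator (X -` B \<inter> space M)) \<omega> = measure (K \<omega>) B))"

end

theory Submission
  imports Defs
begin

text \<open>Write \<open>R = I - P\<close>, \<open>Q = P - \<eta>\<eta>\<^sup>T\<close> and \<open>z = y - \<theta>\<eta>\<close>, and let \<open>S\<close> be the pair \<open>(Q z, \<parallel>z\<parallel>\<^sup>2)\<close>. Since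
  \<open>Q\<mu> = \<mu> - \<theta>\<eta>\<close>, the normal density is a function of \<open>S\<close> alone, and up to a null set the
  selection event says that \<open>\<tau>\<close> lies in a set determined by \<open>S\<close>. So it suffices that under
  Lebesgue measure \<open>\<tau>\<close> and \<open>S\<close> are independent, in the sense that their joint image measure is a
  product whose first factor has density \<open>(1 + t\<^sup>2 / \<nu>) powr (- ((\<nu> + 1) / 2))\<close>.

  For this, integrate first along the line in direction \<open>\<eta>\<close>, substitute
  \<open>\<eta> \<bullet> z = \<parallel>R z\<parallel> t / sqrt \<nu>\<close>, which turns \<open>\<parallel>R z\<parallel>\<^sup>2 + (\<eta> \<bullet> z)\<^sup>2\<close> into \<open>\<parallel>R z\<parallel>\<^sup>2 (1 + t\<^sup>2 / \<nu>)\<close>, and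
  absorb the factor \<open>1 + t\<^sup>2 / \<nu>\<close> by rescaling the range of \<open>R\<close>, whose dimension is \<open>\<nu>\<close>. Everything
  uses only translation invariance of Lebesgue measure and stretchings along unit vectors. The
  normalising constant of the Student density cancels in the truncated law.\<close>

section \<open>Lebesgue integrals under translations and stretchings along unit vectors\<close>

lemma nn_integral_lborel_add:
  fixes F :: "'a::euclidean_space \<Rightarrow> ennreal"
  assumes [measurable]: "F \<in> borel_measurable borel"
  shows "(\<integral>\<^sup>+z. F (a + z) \<partial>lborel) = (\<integral>\<^sup>+z. F z \<partial>lborel)"
  by (subst (2) lborel_distr_plus[of a, symmetric]) (simp add: nn_integral_distr)

text \<open>A fixed probability density \<open>\<phi>\<close> for the coordinate \<open>e \<bullet> z\<close> replaces a choice of coordinates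
  on the orthogonal complement of \<open>e\<close>.\<close>

lemma nn_integral_lborel_along_direction:
  fixes F :: "'a::euclidean_space \<Rightarrow> ennreal" and \<phi> :: "real \<Rightarrow> ennreal"
  assumes [measurable]: "F \<in> borel_measurable borel" "\<phi> \<in> borel_measurable borel"
    and \<phi>: "(\<integral>\<^sup>+x. \<phi> x \<partial>lborel) = 1" and e: "norm e = 1"
  shows "(\<integral>\<^sup>+z. F z \<partial>lborel) =
    (\<integral>\<^sup>+z. \<phi> (e \<bullet> z) * (\<integral>\<^sup>+s. F (z - (e \<bullet> z) *\<^sub>R e + s *\<^sub>R e) \<partial>lborel) \<partial>lborel)"
proof -
  have ee: "e \<bullet> e = 1" using e by (simp add: norm_eq_1)
  have "(\<integral>\<^sup>+z. \<phi> (e \<bullet> z) * (\<integral>\<^sup>+s. F (z - (e \<bullet> z) *\<^sub>R e + s *\<^sub>R e) \<partial>lborel) \<partial>lborel) =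
    (\<integral>\<^sup>+z. \<phi> (e \<bullet> z) * (\<integral>\<^sup>+s. F (s *\<^sub>R e + z) \<partial>lborel) \<partial>lborel)"
  proof (rule nn_integral_cong)
    fix z
    have "(\<integral>\<^sup>+s. F (z - (e \<bullet> z) *\<^sub>R e + s *\<^sub>R e) \<partial>lborel)
       = (\<integral>\<^sup>+s. F (z - (e \<bullet> z) *\<^sub>R e + (e \<bullet> z + s) *\<^sub>R e) \<partial>lborel)"
      by (rule nn_integral_lborel_add[symmetric]) simp
    also have "\<dots> = (\<integral>\<^sup>+s. F (s *\<^sub>R e + z) \<partial>lborel)"
      by (simp add: algebra_simps)
    finally show "\<phi> (e \<bullet> z) * (\<integral>\<^sup>+s. F (z - (e \<bullet> z) *\<^sub>R e + s *\<^sub>R e) \<partial>lborel) =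
      \<phi> (e \<bullet> z) * (\<integral>\<^sup>+s. F (s *\<^sub>R e + z) \<partial>lborel)" by simp
  qed
  also have "\<dots> = (\<integral>\<^sup>+z. (\<integral>\<^sup>+s. \<phi> (e \<bullet> z) * F (s *\<^sub>R e + z) \<partial>lborel) \<partial>lborel)"
    by (simp add: nn_integral_cmult)
  \<comment> \<open>With \<open>s\<close> outside, translating \<open>z\<close> by
    \<open>s *\<^sub>R e\<close> moves the shift from \<open>F\<close> into \<phi>, because
    \<open>e\<close> is a unit vector. After exchanging back, \<phi> alone carries \<open>s\<close>
    and integrates to 1.\<close>
  also have "\<dots> = (\<integral>\<^sup>+s. (\<integral>\<^sup>+z. \<phi> (e \<bullet> z) * F (s *\<^sub>R e + z) \<partial>lborel) \<partial>lborel)"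
    by (rule lborel_pair.Fubini'[symmetric]) simp
  also have "\<dots> = (\<integral>\<^sup>+s. (\<integral>\<^sup>+z. \<phi> (- s + e \<bullet> z) * F z \<partial>lborel) \<partial>lborel)"
  proof (rule nn_integral_cong)
    fix s :: real
    show "(\<integral>\<^sup>+z. \<phi> (e \<bullet> z) * F (s *\<^sub>R e + z) \<partial>lborel) = (\<integral>\<^sup>+z. \<phi> (- s + e \<bullet> z) * F z \<partial>lborel)"
      by (subst nn_integral_lborel_add[of "\<lambda>z. \<phi> (- s + e \<bullet> z) * F z" "s *\<^sub>R e", symmetric])
        (simp_all add: inner_add_right ee)
  qed
  also have "\<dots> = (\<integral>\<^sup>+z. (\<integral>\<^sup>+s. \<phi> (- s + e \<bullet> z) * F z \<partial>lborel) \<partial>lborel)"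
    by (rule lborel_pair.Fubini') simp
  also have "\<dots> = (\<integral>\<^sup>+z. F z \<partial>lborel)"
  proof (rule nn_integral_cong)
    fix z
    have "(\<integral>\<^sup>+s. \<phi> (- s + e \<bullet> z) \<partial>lborel) = 1"
      using nn_integral_real_affine[of \<phi> "-1" "e \<bullet> z"] \<phi> by (simp add: algebra_simps)
    then show "(\<integral>\<^sup>+s. \<phi> (- s + e \<bullet> z) * F z \<partial>lborel) = F z"
      by (simp add: nn_integral_multc)
  qed
  finally show ?thesis by simp
qed

text \<open>The map multiplies the coordinate along \<open>e\<close> by \<open>c\<close> and fixes
  the orthogonal complement. On every line in direction \<open>e\<close> it is a one-dimensional
  substitution with the same factor.\<close>

lemma nn_integral_lborel_stretch_direction:
  fixes F :: "'a::euclidean_space \<Rightarrow> ennreal"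
  assumes [measurable]: "F \<in> borel_measurable borel" and e: "norm e = 1" and c: "c \<noteq> 0"
  shows "(\<integral>\<^sup>+z. F z \<partial>lborel) = ennreal \<bar>c\<bar> * (\<integral>\<^sup>+z. F (z + ((c - 1) * (e \<bullet> z)) *\<^sub>R e) \<partial>lborel)"
proof -
  define \<phi> :: "real \<Rightarrow> ennreal" where "\<phi> = indicator {0..1}"
  have [measurable]: "\<phi> \<in> borel_measurable borel" by (simp add: \<phi>_def)
  have \<phi>: "(\<integral>\<^sup>+x. \<phi> x \<partial>lborel) = 1" by (simp add: \<phi>_def)
  have ee: "e \<bullet> e = 1" using e by (simp add: norm_eq_1)
  have *: "F (z - (e \<bullet> z) *\<^sub>R e + s *\<^sub>R e +
      ((c - 1) * (e \<bullet> (z - (e \<bullet> z) *\<^sub>R e + s *\<^sub>R e))) *\<^sub>R e)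
    = F (z - (e \<bullet> z) *\<^sub>R e + (c * s) *\<^sub>R e)" for z s
    by (simp add: inner_add_right inner_diff_right ee algebra_simps)
  have "(\<integral>\<^sup>+z. F z \<partial>lborel) =
    (\<integral>\<^sup>+z. \<phi> (e \<bullet> z) * (\<integral>\<^sup>+s. F (z - (e \<bullet> z) *\<^sub>R e + s *\<^sub>R e) \<partial>lborel) \<partial>lborel)"
    by (rule nn_integral_lborel_along_direction[OF _ _ \<phi> e]) auto
  also have "\<dots> = (\<integral>\<^sup>+z. \<bar>c\<bar> *
      (\<phi> (e \<bullet> z) * (\<integral>\<^sup>+s. F (z - (e \<bullet> z) *\<^sub>R e + (c * s) *\<^sub>R e) \<partial>lborel)) \<partial>lborel)"
  proof (rule nn_integral_cong)
    fix z
    show "\<phi> (e \<bullet> z) * (\<integral>\<^sup>+s. F (z - (e \<bullet> z) *\<^sub>R e + s *\<^sub>R e) \<partial>lborel) =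
      \<bar>c\<bar> * (\<phi> (e \<bullet> z) * (\<integral>\<^sup>+s. F (z - (e \<bullet> z) *\<^sub>R e + (c * s) *\<^sub>R e) \<partial>lborel))"
      using nn_integral_real_affine[OF _ c, of "\<lambda>s. F (z - (e \<bullet> z) *\<^sub>R e + s *\<^sub>R e)" 0]
      by (simp add: mult_ac)
  qed
  also have "\<dots> = ennreal \<bar>c\<bar> * (\<integral>\<^sup>+z. \<phi> (e \<bullet> z) *
      (\<integral>\<^sup>+s. F (z - (e \<bullet> z) *\<^sub>R e + (c * s) *\<^sub>R e) \<partial>lborel) \<partial>lborel)"
    by (rule nn_integral_cmult) simp
  \<comment> \<open>The stretched function is decomposed along \<open>e\<close> in turn; by
    \<open>*\<close>, its value at coordinate \<open>s\<close> on a line is that of \<open>F\<close>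
    at coordinate \<open>c * s\<close>.\<close>
  also have "(\<integral>\<^sup>+z. \<phi> (e \<bullet> z) *
      (\<integral>\<^sup>+s. F (z - (e \<bullet> z) *\<^sub>R e + (c * s) *\<^sub>R e) \<partial>lborel) \<partial>lborel)
    = (\<integral>\<^sup>+z. F (z + ((c - 1) * (e \<bullet> z)) *\<^sub>R e) \<partial>lborel)"
    by (subst nn_integral_lborel_along_direction[OF _ _ \<phi> e,
          of "\<lambda>z. F (z + ((c - 1) * (e \<bullet> z)) *\<^sub>R e)"]) (simp_all only: *, simp_all)
  finally show ?thesis .
qed

text \<open>A stretching along one direction leaves the orthogonal coordinates alone. Hence the
  single stretchings compose to one that scales the span of \<open>B\<close> by \<open>c\<close>,
  and their factors multiply.\<close>

lemma nn_integral_lborel_stretch_orthonormal: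
  fixes F :: "'a::euclidean_space \<Rightarrow> ennreal"
  assumes "finite B" "pairwise orthogonal B" "\<And>e. e \<in> B \<Longrightarrow> norm e = 1" and c: "c \<noteq> 0"
    and "F \<in> borel_measurable borel"
  shows "(\<integral>\<^sup>+z. F z \<partial>lborel) =
    ennreal (\<bar>c\<bar> ^ card B) * (\<integral>\<^sup>+z. F (z + (c - 1) *\<^sub>R (\<Sum>e\<in>B. (e \<bullet> z) *\<^sub>R e)) \<partial>lborel)"
  using assms(1-3,5)
proof (induction B arbitrary: F rule: finite_induct)
  case empty
  then show ?case by simp
next
  case (insert e B)
  note [measurable] = insert.prems(3)
  have orth: "e' \<bullet> e = 0" if "e' \<in> B" for e'
    using insert.prems insert.hyps that by (auto simp: pairwise_insert orthogonal_def)
  have e: "norm e = 1" using insert.prems by simp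
  \<comment> \<open>The stretching along the new vector is absorbed into the integrand, over which
    the induction hypothesis is quantified.\<close>
  define G where "G z = F (z + ((c - 1) * (e \<bullet> z)) *\<^sub>R e)" for z
  have [measurable]: "G \<in> borel_measurable borel" unfolding G_def by simp
  have G: "G (z + (c - 1) *\<^sub>R (\<Sum>e\<in>B. (e \<bullet> z) *\<^sub>R e))
      = F (z + (c - 1) *\<^sub>R (\<Sum>e\<in>insert e B. (e \<bullet> z) *\<^sub>R e))" for z
  proof -
    have "e \<bullet> (\<Sum>e\<in>B. (e \<bullet> z) *\<^sub>R e) = 0"
      by (auto simp: inner_sum_right orth inner_commute[of e] intro!: sum.neutral)
    then show ?thesis
      using insert.hyps by (simp add: G_def inner_add_right algebra_simps)
  qed
  have "(\<integral>\<^sup>+z. F z \<partial>lborel) = ennreal \<bar>c\<bar> * (\<integral>\<^sup>+z. G z \<partial>lborel)"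
    unfolding G_def by (rule nn_integral_lborel_stretch_direction[OF _ e c]) simp
  also have "\<dots> = ennreal \<bar>c\<bar> * (ennreal (\<bar>c\<bar> ^ card B) *
      (\<integral>\<^sup>+z. G (z + (c - 1) *\<^sub>R (\<Sum>e\<in>B. (e \<bullet> z) *\<^sub>R e)) \<partial>lborel))"
    using insert.prems by (subst insert.IH) (auto simp: pairwise_insert)
  finally show ?case
    using insert.hyps by (simp add: G ennreal_mult mult.assoc del: sum.insert)
qed

section \<open>Orthogonal projections and kernels of matrices\<close>

lemma orthogonal_projection_matrix_vector_mult:
  fixes R :: "real^'n^'n"
  assumes "orthogonal_projection_matrix R"
  shows "R *v (R *v z) = R *v z" and "(R *v x) \<bullet> z = x \<bullet> (R *v z)"
  using assms by (simp_all add: orthogonal_projection_matrix_def matrix_vector_mul_assoc)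
    (metis dot_lmul_matrix transpose_matrix_vector)

text \<open>An orthonormal basis of the range works: \<open>R\<close> is symmetric and fixes each
  \<open>e\<close> in it, so \<open>e \<bullet> (R *v z) = e \<bullet> z\<close>. The trace then
  adds up the squared norms of the basis vectors, which turns the degrees of freedom into a number
  of directions to stretch.\<close>

lemma orthogonal_projection_matrix_orthonormal_basis:
  fixes R :: "real^'n^'n"
  assumes R: "orthogonal_projection_matrix R"
  obtains B where "finite B" "pairwise orthogonal B" "\<And>e. e \<in> B \<Longrightarrow> norm e = 1"
    "\<And>z. R *v z = (\<Sum>e\<in>B. (e \<bullet> z) *\<^sub>R e)" "trace R = card B"
proof -
  note RR = orthogonal_projection_matrix_vector_mult(1)[OF R]
    and sym = orthogonal_projection_matrix_vector_mult(2)[OF R]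
  have sub: "subspace (range ((*v) R))"
    by (intro linear_subspace_image) auto
  obtain B where B: "B \<subseteq> range ((*v) R)" "pairwise orthogonal B"
      "\<And>x. x \<in> B \<Longrightarrow> norm x = 1" "independent B" "span B = range ((*v) R)"
    by (rule orthonormal_basis_subspace[OF sub]) auto
  have fin: "finite B" using B(4) by (rule independent_imp_finite)
  have Re: "R *v e = e" if "e \<in> B" for e using B(1) that RR by auto
  have exp: "R *v z = (\<Sum>e\<in>B. (e \<bullet> z) *\<^sub>R e)" for z
  proof -
    have "R *v z \<in> span B" by (simp add: B)
    then obtain u where u: "R *v z = (\<Sum>e\<in>B. u e *\<^sub>R e)"
      using fin by (auto simp: span_finite)
    have "e \<bullet> (R *v z) = u e" if "e \<in> B" for e
    proof -
      have "e \<bullet> (R *v z) = (\<Sum>e'\<in>B. if e' = e then u e else 0)"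
        unfolding u inner_sum_right
      proof (rule sum.cong)
        fix e' assume "e' \<in> B"
        then show "e \<bullet> u e' *\<^sub>R e' = (if e' = e then u e else 0)"
          using B(2) B(3)[OF that] that by (auto simp: pairwise_def orthogonal_def norm_eq_1)
      qed simp
      then show ?thesis using fin that by simp
    qed
    then have "R *v z = (\<Sum>e\<in>B. (e \<bullet> (R *v z)) *\<^sub>R e)"
      using u by simp
    also have "\<dots> = (\<Sum>e\<in>B. (e \<bullet> z) *\<^sub>R e)"
      by (intro sum.cong) (simp_all add: sym[symmetric] Re)
    finally show ?thesis .
  qed
  have "R $ i $ i = (\<Sum>e\<in>B. e $ i * e $ i)" for i
  proof -
    have "R $ i $ i = (R *v axis i 1) $ i" by (simp add: matrix_vector_mult_basis column_def)
    also have "\<dots> = (\<Sum>e\<in>B. e $ i * e $ i)" by (simp add: exp inner_axis)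
    finally show ?thesis .
  qed
  then have "trace R = (\<Sum>e\<in>B. \<Sum>i\<in>UNIV. e $ i * e $ i)"
    unfolding trace_def by (simp add: sum.swap[of _ UNIV])
  also have "\<dots> = (\<Sum>e\<in>B. 1)"
  proof (rule sum.cong)
    fix e assume "e \<in> B"
    then have "e \<bullet> e = 1" using B(3) norm_eq_1 by blast
    then show "(\<Sum>i\<in>UNIV. e $ i * e $ i) = 1" by (simp add: inner_vec_def)
  qed simp
  finally show ?thesis using that fin B exp by simp
qed

text \<open>The kernel lies in the hyperplane orthogonal to a nonzero row. Applied to
  \<open>I - P\<close>, this discards the points where \<open>sigma_hat\<close> vanishes.\<close>

lemma AE_lborel_matrix_vector_mult_nonzero:
  fixes R :: "real^'n^'m"
  assumes "R \<noteq> 0"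
  shows "AE z in lborel. R *v z \<noteq> 0"
proof -
  obtain i where i: "R $ i \<noteq> 0" using assms by (auto simp: vec_eq_iff)
  have "negligible {z. R $ i \<bullet> z = 0}" using i by (intro negligible_hyperplane) simp
  moreover have "{z. R *v z = 0} \<subseteq> {z. R $ i \<bullet> z = 0}"
    by (auto simp: vec_eq_iff matrix_vector_mul_component)
  ultimately have "negligible {z. R *v z = 0}" by (rule negligible_subset)
  \<comment> \<open>\<open>negligible\<close> refers to the completed measure; a closed set is
    Borel, hence null for \<open>lborel\<close> itself.\<close>
  moreover have "closed {z. R *v z = 0}"
    by (intro closed_Collect_eq continuous_intros)
  ultimately have "{z. R *v z = 0} \<in> null_sets lborel"
    using null_sets_completion_iff[of "{z. R *v z = 0}" lborel]
    by (simp add: negligible_iff_null_sets borel_closed)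
  from AE_not_in[OF this] show ?thesis by simp
qed

section \<open>Product form of Lebesgue measure in the Student coordinate\<close>

text \<open>On the right the first argument of \<open>H\<close> is an integration variable with the
  Student weight, and the other arguments do not involve it. The factor
  \<open>norm (R *v z) / sqrt \<nu>\<close> comes from the substitution for
  \<open>\<eta> \<bullet> z\<close>; \<phi> is the auxiliary density along \<eta>.\<close>

lemma nn_integral_student_decomposition:
  fixes R :: "real^'n^'n" and \<eta> :: "real^'n" and \<phi> :: "real \<Rightarrow> ennreal"
    and H :: "real \<times> (real^'n) \<times> real \<Rightarrow> ennreal"
  assumes R: "orthogonal_projection_matrix R" and tr: "trace R \<noteq> 0"
    and \<eta>: "norm \<eta> = 1" and R\<eta>: "R *v \<eta> = 0"
    and [measurable]: "\<phi> \<in> borel_measurable borel" "H \<in> borel_measurable borel"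
    and \<phi>: "(\<integral>\<^sup>+x. \<phi> x \<partial>lborel) = 1"
  defines "\<nu> \<equiv> trace R"
  shows "(\<integral>\<^sup>+z. H (sqrt \<nu> * (\<eta> \<bullet> z) / norm (R *v z), z - R *v z - (\<eta> \<bullet> z) *\<^sub>R \<eta>,
                 (norm (R *v z))\<^sup>2 + (\<eta> \<bullet> z)\<^sup>2) \<partial>lborel) =
    (\<integral>\<^sup>+z. \<phi> (\<eta> \<bullet> z) * ennreal (norm (R *v z) / sqrt \<nu>) *
       (\<integral>\<^sup>+t. ennreal ((1 + t\<^sup>2 / \<nu>) powr (- ((\<nu> + 1) / 2))) *
          H (t, z - R *v z - (\<eta> \<bullet> z) *\<^sub>R \<eta>, (norm (R *v z))\<^sup>2) \<partial>lborel) \<partial>lborel)"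
proof -
  obtain B where B: "finite B" "pairwise orthogonal B" "\<And>e. e \<in> B \<Longrightarrow> norm e = 1"
    and RB: "\<And>z. R *v z = (\<Sum>e\<in>B. (e \<bullet> z) *\<^sub>R e)" and trB: "trace R = card B"
    using orthogonal_projection_matrix_orthonormal_basis[OF R] by blast
  have \<nu>: "\<nu> > 0" "\<nu> = card B" using tr trB by (auto simp: \<nu>_def)
  have \<eta>\<eta>: "\<eta> \<bullet> \<eta> = 1" using \<eta> by (simp add: norm_eq_1)
  note RR = orthogonal_projection_matrix_vector_mult(1)[OF R]
    and sym = orthogonal_projection_matrix_vector_mult(2)[OF R]
  have \<eta>R: "\<eta> \<bullet> (R *v z) = 0" for z by (simp add: sym[symmetric] R\<eta>)
  define Q where "Q z = z - R *v z - (\<eta> \<bullet> z) *\<^sub>R \<eta>" for z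
  have [measurable]: "(\<lambda>z. R *v z) \<in> borel \<rightarrow>\<^sub>M borel"
    by (intro borel_measurable_continuous_onI) (auto intro!: continuous_intros)
  have [measurable]: "Q \<in> borel \<rightarrow>\<^sub>M borel" unfolding Q_def by measurable
  have R_lin: "R *v (x + y) = R *v x + R *v y" "R *v (x - y) = R *v x - R *v y"
      "R *v (c *\<^sub>R x) = c *\<^sub>R (R *v x)" for x y c
    by (simp_all add: matrix_vector_right_distrib matrix_vector_mult_diff_distrib
        matrix_vector_mult_scaleR)
  have R0: "R \<noteq> 0" using tr by (auto simp: trace_def)
  let ?J = "\<lambda>t. 1 + t\<^sup>2 / \<nu>"
  have J: "?J t > 0" for t using \<nu> by (simp add: add_pos_nonneg)
  have "(\<integral>\<^sup>+z. H (sqrt \<nu> * (\<eta> \<bullet> z) / norm (R *v z), Q z, (norm (R *v z))\<^sup>2 + (\<eta> \<bullet> z)\<^sup>2) \<partial>lborel)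
    = (\<integral>\<^sup>+z. \<phi> (\<eta> \<bullet> z) *
        (\<integral>\<^sup>+s. H (sqrt \<nu> * s / norm (R *v z), Q z, (norm (R *v z))\<^sup>2 + s\<^sup>2) \<partial>lborel) \<partial>lborel)"
  proof (subst nn_integral_lborel_along_direction[OF _ _ \<phi> \<eta>])
    \<comment> \<open>Since \<open>R *v \<eta> = 0\<close>, both \<open>R *v z\<close> and
      \<open>Q z\<close> are constant on lines in direction \<eta>.\<close>
    have "\<eta> \<bullet> (z - (\<eta> \<bullet> z) *\<^sub>R \<eta> + s *\<^sub>R \<eta>) = s"
      "R *v (z - (\<eta> \<bullet> z) *\<^sub>R \<eta> + s *\<^sub>R \<eta>) = R *v z"
      "Q (z - (\<eta> \<bullet> z) *\<^sub>R \<eta> + s *\<^sub>R \<eta>) = Q z" for z s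
      by (simp_all add: Q_def inner_add_right inner_diff_right \<eta>\<eta> R_lin R\<eta>)
    then show "(\<integral>\<^sup>+z. \<phi> (\<eta> \<bullet> z) * (\<integral>\<^sup>+s. H
        (sqrt \<nu> * (\<eta> \<bullet> (z - (\<eta> \<bullet> z) *\<^sub>R \<eta> + s *\<^sub>R \<eta>)) / norm (R *v (z - (\<eta> \<bullet> z) *\<^sub>R \<eta> + s *\<^sub>R \<eta>)),
         Q (z - (\<eta> \<bullet> z) *\<^sub>R \<eta> + s *\<^sub>R \<eta>),
         (norm (R *v (z - (\<eta> \<bullet> z) *\<^sub>R \<eta> + s *\<^sub>R \<eta>)))\<^sup>2 + (\<eta> \<bullet> (z - (\<eta> \<bullet> z) *\<^sub>R \<eta> + s *\<^sub>R \<eta>))\<^sup>2)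
         \<partial>lborel) \<partial>lborel) =
       (\<integral>\<^sup>+z. \<phi> (\<eta> \<bullet> z) *
        (\<integral>\<^sup>+s. H (sqrt \<nu> * s / norm (R *v z), Q z, (norm (R *v z))\<^sup>2 + s\<^sup>2) \<partial>lborel) \<partial>lborel)"
      by simp
  qed measurable
  also have "\<dots> = (\<integral>\<^sup>+z. (\<integral>\<^sup>+t. \<phi> (\<eta> \<bullet> z) * ennreal (norm (R *v z) / sqrt \<nu>) *
      H (t, Q z, (norm (R *v z))\<^sup>2 * ?J t) \<partial>lborel) \<partial>lborel)"
  \<comment> \<open>The substitution \<open>s = norm (R *v z) * t / sqrt \<nu>\<close> requires
    \<open>R *v z \<noteq> 0\<close>, which holds almost everywhere.\<close>
  proof (rule nn_integral_cong_AE)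
    show "AE z in lborel. \<phi> (\<eta> \<bullet> z) *
        (\<integral>\<^sup>+s. H (sqrt \<nu> * s / norm (R *v z), Q z, (norm (R *v z))\<^sup>2 + s\<^sup>2) \<partial>lborel) =
        (\<integral>\<^sup>+t. \<phi> (\<eta> \<bullet> z) * ennreal (norm (R *v z) / sqrt \<nu>) *
          H (t, Q z, (norm (R *v z))\<^sup>2 * ?J t) \<partial>lborel)"
      using AE_lborel_matrix_vector_mult_nonzero[OF R0]
    proof eventually_elim
      fix z assume "R *v z \<noteq> 0"
      then have c: "norm (R *v z) / sqrt \<nu> \<noteq> 0" "norm (R *v z) \<noteq> 0" using \<nu> by auto
      have "(\<integral>\<^sup>+s. H (sqrt \<nu> * s / norm (R *v z), Q z, (norm (R *v z))\<^sup>2 + s\<^sup>2) \<partial>lborel) =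
        ennreal (norm (R *v z) / sqrt \<nu>) *
          (\<integral>\<^sup>+t. H (sqrt \<nu> * (0 + norm (R *v z) / sqrt \<nu> * t) / norm (R *v z), Q z,
             (norm (R *v z))\<^sup>2 + (0 + norm (R *v z) / sqrt \<nu> * t)\<^sup>2) \<partial>lborel)"
        using \<nu> by (subst nn_integral_real_affine[OF _ c(1), of _ 0]) auto
      also have "\<dots> = ennreal (norm (R *v z) / sqrt \<nu>) *
          (\<integral>\<^sup>+t. H (t, Q z, (norm (R *v z))\<^sup>2 * ?J t) \<partial>lborel)"
        using c \<nu> by (simp add: power_mult_distrib power_divide algebra_simps)
      finally show "\<phi> (\<eta> \<bullet> z) *
        (\<integral>\<^sup>+s. H (sqrt \<nu> * s / norm (R *v z), Q z, (norm (R *v z))\<^sup>2 + s\<^sup>2) \<partial>lborel) =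
        (\<integral>\<^sup>+t. \<phi> (\<eta> \<bullet> z) * ennreal (norm (R *v z) / sqrt \<nu>) *
          H (t, Q z, (norm (R *v z))\<^sup>2 * ?J t) \<partial>lborel)"
        by (simp add: nn_integral_cmult mult.assoc)
    qed
  qed
  \<comment> \<open>With \<open>t\<close> fixed outside, the stretching applied to \<open>z\<close>
    may depend on \<open>t\<close>.\<close>
  also have "\<dots> = (\<integral>\<^sup>+t. (\<integral>\<^sup>+z. \<phi> (\<eta> \<bullet> z) * ennreal (norm (R *v z) / sqrt \<nu>) *
      H (t, Q z, (norm (R *v z))\<^sup>2 * ?J t) \<partial>lborel) \<partial>lborel)"
    by (rule lborel_pair.Fubini') measurable
  also have "\<dots> = (\<integral>\<^sup>+t. (\<integral>\<^sup>+z. \<phi> (\<eta> \<bullet> z) * ennreal (norm (R *v z) / sqrt \<nu>) *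
      (ennreal (?J t powr (- ((\<nu> + 1) / 2))) * H (t, Q z, (norm (R *v z))\<^sup>2)) \<partial>lborel) \<partial>lborel)"
  proof (rule nn_integral_cong)
    fix t :: real
    \<comment> \<open>Stretching the range of \<open>R\<close> by this \<open>c\<close> multiplies
      \<open>(norm (R *v z))\<^sup>2\<close> by \<open>c\<^sup>2\<close>, the inverse of
      \<open>1 + t\<^sup>2 / \<nu>\<close>, and preserves \<open>\<eta> \<bullet> z\<close> and
      \<open>Q z\<close>.\<close>
    define c where "c = ?J t powr (- (1 / 2))"
    have c: "c > 0" using J[of t] by (simp add: c_def)
    have c2: "c\<^sup>2 * ?J t = 1"
      using J[of t] by (simp add: c_def powr_minus_divide powr_half_sqrt power_divide)
    have c2': "(c * x)\<^sup>2 * ?J t = x\<^sup>2" for x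
    proof -
      have "(c * x)\<^sup>2 * ?J t = (c\<^sup>2 * ?J t) * x\<^sup>2" by (simp only: power_mult_distrib mult_ac)
      then show ?thesis using c2 by simp
    qed
    \<comment> \<open>The Student exponent: \<nu> factors \<open>c\<close> stem from the change of
      volume, one more from the weight \<open>norm (R *v z) / sqrt \<nu>\<close>.\<close>
    have cpow: "c ^ card B * c = ?J t powr (- ((\<nu> + 1) / 2))"
    proof -
      have "c ^ card B * c = c powr (\<nu> + 1)" using c by (simp add: powr_add \<nu>(2) powr_realpow)
      then show ?thesis by (simp add: c_def powr_powr field_simps)
    qed
    have st: "z + (c - 1) *\<^sub>R (\<Sum>e\<in>B. (e \<bullet> z) *\<^sub>R e) = z + (c - 1) *\<^sub>R (R *v z)" for z
      by (simp add: RB)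
    have inv: "R *v (z + (c - 1) *\<^sub>R (R *v z)) = c *\<^sub>R (R *v z)"
      "\<eta> \<bullet> (z + (c - 1) *\<^sub>R (R *v z)) = \<eta> \<bullet> z" "Q (z + (c - 1) *\<^sub>R (R *v z)) = Q z" for z
      by (simp_all add: Q_def R_lin RR inner_add_right \<eta>R algebra_simps)
    have "(\<integral>\<^sup>+z. \<phi> (\<eta> \<bullet> z) * ennreal (norm (R *v z) / sqrt \<nu>) *
      H (t, Q z, (norm (R *v z))\<^sup>2 * ?J t) \<partial>lborel) = ennreal (c ^ card B) *
        (\<integral>\<^sup>+z. \<phi> (\<eta> \<bullet> z) * ennreal (c * norm (R *v z) / sqrt \<nu>) *
           H (t, Q z, (norm (R *v z))\<^sup>2) \<partial>lborel)"
      using c c2' by (subst nn_integral_lborel_stretch_orthonormal[OF B, where c=c])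
        (simp_all add: st inv)
    also have "\<dots> = ennreal (c ^ card B) * (\<integral>\<^sup>+z. ennreal c *
        (\<phi> (\<eta> \<bullet> z) * ennreal (norm (R *v z) / sqrt \<nu>) * H (t, Q z, (norm (R *v z))\<^sup>2)) \<partial>lborel)"
    proof -
      have "ennreal (c * norm (R *v z) / sqrt \<nu>) = ennreal c * ennreal (norm (R *v z) / sqrt \<nu>)" for z
        using c \<nu> by (subst ennreal_mult[symmetric]) auto
      then show ?thesis by (simp only: mult_ac)
    qed
    also have "\<dots> = ennreal (c ^ card B * c) * (\<integral>\<^sup>+z. 
        (\<phi> (\<eta> \<bullet> z) * ennreal (norm (R *v z) / sqrt \<nu>) * H (t, Q z, (norm (R *v z))\<^sup>2)) \<partial>lborel)"
      using c by (simp add: nn_integral_cmult ennreal_mult mult.assoc)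
    also have "\<dots> = (\<integral>\<^sup>+z. \<phi> (\<eta> \<bullet> z) * ennreal (norm (R *v z) / sqrt \<nu>) *
      (ennreal (?J t powr (- ((\<nu> + 1) / 2))) * H (t, Q z, (norm (R *v z))\<^sup>2)) \<partial>lborel)"
      unfolding cpow by (subst nn_integral_cmult[symmetric]) (simp_all add: mult_ac)
    finally show "(\<integral>\<^sup>+z. \<phi> (\<eta> \<bullet> z) * ennreal (norm (R *v z) / sqrt \<nu>) *
      H (t, Q z, (norm (R *v z))\<^sup>2 * ?J t) \<partial>lborel) = \<dots>" .
  qed
  also have "\<dots> = (\<integral>\<^sup>+z. (\<integral>\<^sup>+t. \<phi> (\<eta> \<bullet> z) * ennreal (norm (R *v z) / sqrt \<nu>) *
      (ennreal (?J t powr (- ((\<nu> + 1) / 2))) * H (t, Q z, (norm (R *v z))\<^sup>2)) \<partial>lborel) \<partial>lborel)"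
    by (rule lborel_pair.Fubini') measurable
  also have "\<dots> = (\<integral>\<^sup>+z. \<phi> (\<eta> \<bullet> z) * ennreal (norm (R *v z) / sqrt \<nu>) * (\<integral>\<^sup>+t. 
      (ennreal (?J t powr (- ((\<nu> + 1) / 2))) * H (t, Q z, (norm (R *v z))\<^sup>2)) \<partial>lborel) \<partial>lborel)"
    by (simp add: nn_integral_cmult)
  finally show ?thesis by (simp add: Q_def)
qed

section \<open>Truncated conditional laws from an iterated integral\<close>

text \<open>The integrals are iterated, with \<open>\<kappa>\<close> inside, so that \<open>\<Lambda>\<close> need not be sigma-finite.\<close>

lemma is_conditional_law_uniform_measure:
  fixes X :: "'a \<Rightarrow> real" and S :: "'a \<Rightarrow> 'b::topological_space" and \<kappa> :: "real measure"
    and \<Lambda> :: "'b measure" and G :: "'b \<Rightarrow> real set"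
  assumes "prob_space M" and X [measurable]: "X \<in> borel_measurable M"
    and S [measurable]: "S \<in> borel_measurable M"
    and "finite_measure \<kappa>" and sets_\<kappa> [measurable_cong]: "sets \<kappa> = sets borel"
    and sets_\<Lambda> [measurable_cong]: "sets \<Lambda> = sets borel"
    and G: "{p. snd p \<in> G (fst p)} \<in> sets (borel \<Otimes>\<^sub>M borel)"
    and law: "\<And>h. h \<in> borel_measurable (borel \<Otimes>\<^sub>M borel) \<Longrightarrow>
      (\<integral>\<^sup>+\<omega>. h (S \<omega>, X \<omega>) \<partial>M) = (\<integral>\<^sup>+s. (\<integral>\<^sup>+t. indicator (G s) t * h (s, t) \<partial>\<kappa>) \<partial>\<Lambda>)"
  shows "is_conditional_law M X S (\<lambda>\<omega>. uniform_measure \<kappa> (G (S \<omega>)))"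
proof -
  interpret prob_space M by fact
  interpret \<kappa>: finite_measure \<kappa> by fact
  define F where "F = vimage_algebra (space M) S borel"
  have space_\<kappa>: "space \<kappa> = UNIV" using sets_eq_imp_space_eq[OF sets_\<kappa>] by simp
  have G' [measurable]: "{p \<in> space (borel \<Otimes>\<^sub>M \<kappa>). snd p \<in> G (fst p)} \<in> sets (borel \<Otimes>\<^sub>M \<kappa>)"
    using G sets_pair_measure_cong[OF refl sets_\<kappa>, of "borel :: 'b measure"]
    by (simp add: space_pair_measure space_\<kappa>)
  have Gpred [measurable]: "Measurable.pred (borel \<Otimes>\<^sub>M borel) (\<lambda>p. snd p \<in> G (fst p))"
    using G by (simp add: pred_def space_pair_measure)
  have Gs [measurable]: "G s \<in> sets borel" for s
  proof -
    have "Measurable.pred borel (\<lambda>t. snd (s, t) \<in> G (fst (s, t)))"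
      by (rule measurable_compose[OF _ Gpred]) measurable
    then show ?thesis by (simp add: pred_def)
  qed
  have em [measurable]: "(\<lambda>s. emeasure \<kappa> (G s \<inter> B)) \<in> borel_measurable borel"
    if [measurable]: "B \<in> sets borel" for B
  proof (rule \<kappa>.measurable_emeasure)
    have "Measurable.pred (borel \<Otimes>\<^sub>M borel) (\<lambda>p. snd p \<in> G (fst p) \<and> snd p \<in> B)" by measurable
    then show "{p \<in> space (borel \<Otimes>\<^sub>M \<kappa>). snd p \<in> G (fst p) \<inter> B} \<in> sets (borel \<Otimes>\<^sub>M \<kappa>)"
      using sets_pair_measure_cong[OF refl sets_\<kappa>, of "borel :: 'b measure"]
      by (simp add: space_pair_measure space_\<kappa> pred_def)
  qed (simp add: space_\<kappa>)
  have em1 [measurable]: "(\<lambda>s. emeasure \<kappa> (G s)) \<in> borel_measurable borel"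
    using em[of UNIV] by simp
  \<comment> \<open>In \<open>ennreal\<close>, \<open>0 / 0 = 0\<close>, so over a null
    \<open>G s\<close> the kernel is the zero measure, still a subprobability.\<close>
  define k where "k s B = emeasure \<kappa> (G s \<inter> B) / emeasure \<kappa> (G s)" for s B
  have k: "emeasure (uniform_measure \<kappa> (G s)) B = k s B" if "B \<in> sets borel" for s B
    using that by (simp add: k_def sets_\<kappa>)
  have k_meas [measurable]: "(\<lambda>s. k s B) \<in> borel_measurable borel" if "B \<in> sets borel" for B
    using that unfolding k_def by measurable
  have S_F: "S \<in> F \<rightarrow>\<^sub>M borel"
    unfolding F_def by (rule measurable_vimage_algebra1) simp
  have fin: "emeasure \<kappa> A \<noteq> \<infinity>" for A by (simp add: \<kappa>.emeasure_finite)
  have fin_top: "emeasure \<kappa> A < \<top>" for A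
    by (metis fin infinity_ennreal_def less_top)
  have k_UNIV: "k s UNIV = (if emeasure \<kappa> (G s) = 0 then 0 else 1)" for s
    using fin_top[of "G s"] by (simp add: k_def)
  have k_le: "k s B \<le> 1" if "B \<in> sets borel" for s B
  proof -
    have "k s B \<le> k s UNIV"
      unfolding k_def using that
      by (intro divide_right_mono_ennreal emeasure_mono) (auto simp: sets_\<kappa>)
    also have "\<dots> \<le> 1" by (simp add: k_UNIV)
    finally show ?thesis .
  qed
  have kernel: "(\<lambda>\<omega>. uniform_measure \<kappa> (G (S \<omega>))) \<in> F \<rightarrow>\<^sub>M subprob_algebra borel"
  proof (rule measurable_subprob_algebra)
    fix \<omega>
    show "subprob_space (uniform_measure \<kappa> (G (S \<omega>)))"
      using k[of UNIV] k_le[of UNIV] by (intro subprob_spaceI) (auto simp: space_\<kappa>)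
    show "sets (uniform_measure \<kappa> (G (S \<omega>))) = sets borel" by (simp add: sets_\<kappa>)
  next
    fix A :: "real set" assume A: "A \<in> sets borel"
    then show "(\<lambda>\<omega>. emeasure (uniform_measure \<kappa> (G (S \<omega>))) A) \<in> borel_measurable F"
      unfolding k[OF A] by (intro measurable_compose[OF S_F k_meas])
  qed
  have prob_AE: "AE \<omega> in M. prob_space (uniform_measure \<kappa> (G (S \<omega>)))"
  proof -
    \<comment> \<open>Testing \<open>law\<close> on the set of \<open>s\<close> with null
      \<open>G s\<close> makes the inner integral vanish, so \<open>S\<close> almost surely avoids
      this set.\<close>
    have "(\<integral>\<^sup>+\<omega>. indicator {s. emeasure \<kappa> (G s) = 0} (S \<omega>) \<partial>M) =
       (\<integral>\<^sup>+s. (\<integral>\<^sup>+t. indicator (G s) t * indicator {s. emeasure \<kappa> (G s) = 0} s \<partial>\<kappa>) \<partial>\<Lambda>)"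
      using law[of "\<lambda>p. indicator {s. emeasure \<kappa> (G s) = 0} (fst p)"] by simp
    also have "\<dots> = 0"
      by (simp add: nn_integral_multc) (auto simp: indicator_def intro!: nn_integral_zero' )
    finally have "AE \<omega> in M. indicator {s. emeasure \<kappa> (G s) = 0} (S \<omega>) = (0::ennreal)"
      by (subst (asm) nn_integral_0_iff_AE) auto
    then show ?thesis
    proof eventually_elim
      fix \<omega> assume "indicator {s. emeasure \<kappa> (G s) = 0} (S \<omega>) = (0::ennreal)"
      then have "emeasure \<kappa> (G (S \<omega>)) \<noteq> 0" by (auto simp: indicator_def split: if_splits)
      then show "prob_space (uniform_measure \<kappa> (G (S \<omega>)))"
        using fin by (intro prob_space_uniform_measure) auto
    qed
  qed
  interpret F: finite_measure_subalgebra M F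
  proof
    show "subalgebra M F"
      using measurable_sets[OF S] by (auto simp: subalgebra_def F_def sets_vimage_algebra2)
  qed
  have cond: "AE \<omega> in M. real_cond_exp M F (indicator (X -` B \<inter> space M)) \<omega> =
      measure (uniform_measure \<kappa> (G (S \<omega>))) B" if B [measurable]: "B \<in> sets borel" for B
  proof -
    have m: "measure (uniform_measure \<kappa> (G s)) B = enn2real (k s B)" for s
      unfolding measure_def by (simp only: k[OF B])
    have kB: "(\<lambda>\<omega>. enn2real (k (S \<omega>) B)) \<in> borel_measurable F"
      by (intro borel_measurable_enn2real measurable_compose[OF S_F k_meas] B)
    have kr: "ennreal (enn2real (k s B)) = k s B" for s
      using k_le[OF B, of s] by (intro ennreal_enn2real) (auto simp: top_unique less_top intro: le_less_trans)
    show ?thesis unfolding m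
    proof (rule F.real_cond_exp_charact)
      show "integrable M (indicat_real (X -` B \<inter> space M))"
        by (rule integrable_const_bound[where B=1]) auto
      show "integrable M (\<lambda>\<omega>. enn2real (k (S \<omega>) B))"
        using k_le[OF B] by (intro integrable_const_bound[where B=1]) (auto intro!: enn2real_leI)
      show "(\<lambda>\<omega>. enn2real (k (S \<omega>) B)) \<in> borel_measurable F" by (rule kB)
    next
      fix A assume "A \<in> sets F"
      then obtain D where D [measurable]: "D \<in> sets borel" and A: "A = S -` D \<inter> space M"
        unfolding F_def by (auto simp: sets_vimage_algebra2)
      have [measurable]: "A \<in> sets M" unfolding A by simp
      \<comment> \<open>By \<open>law\<close>, both sides equal the integral over \<open>D\<close>
        of \<open>emeasure \<kappa> (G s \<inter> B)\<close> against \<Lambda>: the factor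
        \<open>k s B\<close> does not involve \<open>t\<close>, so it is multiplied by
        \<open>emeasure \<kappa> (G s)\<close>.\<close>
      have "(\<integral>\<^sup>+\<omega>. indicator D (S \<omega>) * indicator B (X \<omega>) \<partial>M) =
        (\<integral>\<^sup>+s. (\<integral>\<^sup>+t. indicator D s * indicator (G s \<inter> B) t \<partial>\<kappa>) \<partial>\<Lambda>)"
        by (subst law[of "\<lambda>p. indicator D (fst p) * indicator B (snd p)", simplified])
          (simp_all add: indicator_inter_arith mult_ac)
      also have "\<dots> = (\<integral>\<^sup>+s. indicator D s * (k s B * emeasure \<kappa> (G s)) \<partial>\<Lambda>)"
      proof (rule nn_integral_cong)
        fix s
        have "emeasure \<kappa> (G s \<inter> B) = k s B * emeasure \<kappa> (G s)"
        proof (cases "emeasure \<kappa> (G s) = 0")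
          case True
          moreover have "emeasure \<kappa> (G s \<inter> B) \<le> emeasure \<kappa> (G s)"
            by (intro emeasure_mono) (auto simp: sets_\<kappa>)
          ultimately show ?thesis by simp
        next
          case False
          then show ?thesis
            unfolding k_def ennreal_divide_times using fin_top[of "G s"] by simp
        qed
        then show "(\<integral>\<^sup>+t. indicator D s * indicator (G s \<inter> B) t \<partial>\<kappa>) =
          indicator D s * (k s B * emeasure \<kappa> (G s))"
          by (simp add: nn_integral_cmult sets_\<kappa>)
      qed
      also have "\<dots> = (\<integral>\<^sup>+s. (\<integral>\<^sup>+t. indicator (G s) t * (indicator D s * k s B) \<partial>\<kappa>) \<partial>\<Lambda>)"
        by (intro nn_integral_cong) (simp add: nn_integral_multc sets_\<kappa>, simp add: mult_ac)
      also have "\<dots> = (\<integral>\<^sup>+\<omega>. indicator D (S \<omega>) * k (S \<omega>) B \<partial>M)"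
        by (subst law[of "\<lambda>p. indicator D (fst p) * k (fst p) B", simplified]) auto
      finally have *: "(\<integral>\<^sup>+\<omega>. indicator D (S \<omega>) * indicator B (X \<omega>) \<partial>M) =
        (\<integral>\<^sup>+\<omega>. indicator D (S \<omega>) * k (S \<omega>) B \<partial>M)" .
      have "(\<integral>\<omega>\<in>A. indicat_real (X -` B \<inter> space M) \<omega> \<partial>M) =
          enn2real (\<integral>\<^sup>+\<omega>. ennreal (indicator A \<omega> * indicat_real (X -` B \<inter> space M) \<omega>) \<partial>M)"
        unfolding set_lebesgue_integral_def by (subst integral_eq_nn_integral) auto
      also have "(\<integral>\<^sup>+\<omega>. ennreal (indicator A \<omega> * indicat_real (X -` B \<inter> space M) \<omega>) \<partial>M)
          = (\<integral>\<^sup>+\<omega>. indicator D (S \<omega>) * indicator B (X \<omega>) \<partial>M)"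
        by (intro nn_integral_cong) (auto simp: A indicator_def)
      also have "\<dots> = (\<integral>\<^sup>+\<omega>. ennreal (indicator A \<omega> * enn2real (k (S \<omega>) B)) \<partial>M)"
        unfolding * by (intro nn_integral_cong) (auto simp: A indicator_def kr)
      also have "enn2real \<dots> = (\<integral>\<omega>\<in>A. enn2real (k (S \<omega>) B) \<partial>M)"
        unfolding set_lebesgue_integral_def
        using measurable_from_subalg[OF F.subalg kB] by (subst integral_eq_nn_integral) auto
      finally show "(\<integral>\<omega>\<in>A. indicat_real (X -` B \<inter> space M) \<omega> \<partial>M) =
         (\<integral>\<omega>\<in>A. enn2real (k (S \<omega>) B) \<partial>M)" .
    qed
  qed
  show ?thesis
    unfolding is_conditional_law_def Let_def F_def[symmetric]
    using X S kernel prob_AE cond by auto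
qed

section \<open>The Student and normal densities\<close>

lemma student_density_measurable [measurable]: "student_density \<nu> \<in> borel_measurable borel"
  unfolding student_density_def by measurable

text \<open>Comparison with the Cauchy density: for \<nu> at least 1 the exponent
  \<open>(\<nu> + 1) / 2\<close> is at least 1, and \<open>\<nu> + t\<^sup>2\<close> is at least
  \<open>1 + t\<^sup>2\<close>.\<close>

lemma finite_measure_student_law:
  assumes \<nu>: "\<nu> \<ge> 1"
  shows "finite_measure (student_law \<nu>)"
proof
  define c where "c = Gamma ((\<nu> + 1) / 2) / (sqrt (\<nu> * pi) * Gamma (\<nu> / 2))"
  have c: "c > 0" using \<nu> by (simp add: c_def)
  have le: "student_density \<nu> t \<le> c * \<nu> * inverse (1 + t\<^sup>2)" for t
  proof -
    have 1: "1 + t\<^sup>2 / \<nu> \<ge> 1" using \<nu> by simp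
    then have "(1 + t\<^sup>2 / \<nu>) powr (- ((\<nu> + 1) / 2)) \<le> (1 + t\<^sup>2 / \<nu>) powr (- 1)"
      using \<nu> by (intro powr_mono) auto
    also have "\<dots> = inverse (1 + t\<^sup>2 / \<nu>)" using 1 by (simp add: powr_minus)
    also have "\<dots> = \<nu> / (\<nu> + t\<^sup>2)" using \<nu> by (simp add: field_simps)
    also have "\<dots> \<le> \<nu> / (1 + t\<^sup>2)"
      using \<nu> by (intro divide_left_mono) (auto intro!: mult_pos_pos add_pos_nonneg)
    finally have "(1 + t\<^sup>2 / \<nu>) powr (- ((\<nu> + 1) / 2)) \<le> \<nu> * inverse (1 + t\<^sup>2)"
      by (simp only: divide_inverse)
    then have "c * (1 + t\<^sup>2 / \<nu>) powr (- ((\<nu> + 1) / 2)) \<le> c * (\<nu> * inverse (1 + t\<^sup>2))"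
      using c by (intro mult_left_mono) auto
    then show ?thesis unfolding student_density_def c_def[symmetric] by (simp only: mult.assoc)
  qed
  have "integrable lborel (\<lambda>t. inverse (1 + t\<^sup>2 :: real))"
    using integrable_inverse_1_plus_square
    by (simp add: set_integrable_def)
  then have "integrable lborel (\<lambda>t. c * \<nu> * inverse (1 + t\<^sup>2 :: real))" by simp
  then have "(\<integral>\<^sup>+t. ennreal (c * \<nu> * inverse (1 + t\<^sup>2)) \<partial>lborel) < \<infinity>"
    using c \<nu> by (subst nn_integral_eq_integral) auto
  moreover have "emeasure (student_law \<nu>) (space (student_law \<nu>)) \<le>
      (\<integral>\<^sup>+t. ennreal (c * \<nu> * inverse (1 + t\<^sup>2)) \<partial>lborel)"
    unfolding student_law_def using le
    by (subst emeasure_density) (auto simp: student_density_measurable intro!: nn_integral_mono ennreal_leI)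
  ultimately show "emeasure (student_law \<nu>) (space (student_law \<nu>)) \<noteq> \<infinity>" by auto
qed

text \<open>In this form the exponent can be expanded about \<open>\<theta> *\<^sub>R \<eta>\<close>
  by inner products, which exhibits the density as a function of the conditioning pair.\<close>

lemma isotropic_normal_eq_density_norm:
  fixes \<mu> :: "real^'n"
  shows "isotropic_normal \<mu> \<sigma> = density lborel
    (\<lambda>x. ennreal ((1 / sqrt (2 * pi * \<sigma>\<^sup>2)) ^ CARD('n) * exp (- ((norm (x - \<mu>))\<^sup>2 / (2 * \<sigma>\<^sup>2)))))"
proof -
  have "(\<Prod>i\<in>UNIV. normal_density (\<mu> $ i) \<sigma> (x $ i)) =
      (1 / sqrt (2 * pi * \<sigma>\<^sup>2)) ^ CARD('n) * exp (- ((norm (x - \<mu>))\<^sup>2 / (2 * \<sigma>\<^sup>2)))" for x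
  proof -
    have "(norm (x - \<mu>))\<^sup>2 = (\<Sum>i\<in>UNIV. (x $ i - \<mu> $ i)\<^sup>2)"
      unfolding power2_norm_eq_inner inner_vec_def by (simp add: power2_eq_square)
    then show ?thesis
      by (simp add: normal_density_def prod.distrib exp_sum[symmetric] sum_negf
          sum_divide_distrib[symmetric] prod_dividef power_one_over)
  qed
  then show ?thesis by (simp add: isotropic_normal_def)
qed

section \<open>The selection event as a truncation\<close>

lemma selection_event_measurable: "selection_event C b P \<in> sets borel"
proof -
  have "selection_event C b P = (\<Inter>i. {y. (C *v y) $ i \<le> sigma_hat P y * b $ i})"
    by (auto simp: selection_event_def less_eq_vec_def)
  moreover have "closed \<dots>"
    \<comment> \<open>As multiplication by a constant, the division is continuous without a
      condition on the denominator.\<close>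
    unfolding sigma_hat_def divide_inverse
    by (intro closed_INT ballI closed_Collect_le continuous_intros)
  ultimately show ?thesis by (simp add: borel_closed)
qed

text \<open>Both sides of the defining inequality of the truncation set are those of the selection
  event multiplied by \<open>sqrt (resid_df P) * sqrt w / norm ((mat 1 - P) *v y)\<close>.\<close>

lemma selection_event_iff_truncation_set:
  fixes P :: "real^'n^'n" and C :: "real^'n^'m"
  assumes CP: "C ** P = C" and \<nu>: "resid_df P > 0"
    and Py: "P *v y = (\<eta> \<bullet> y) *\<^sub>R \<eta> + v"
    and R: "(mat 1 - P) *v y \<noteq> 0"
    and w: "w = (norm ((mat 1 - P) *v y))\<^sup>2 + (\<eta> \<bullet> y - \<theta>)\<^sup>2"
  shows "y \<in> selection_event C b P \<longleftrightarrow>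
    tau_stat P \<eta> \<theta> y \<in> truncation_set \<eta> C b P w v \<theta>"
proof -
  define \<nu> where "\<nu> = resid_df P"
  define r where "r = norm ((mat 1 - P) *v y)"
  define u where "u = \<eta> \<bullet> y - \<theta>"
  have pos: "\<nu> > 0" "r > 0" "w > 0"
    using \<nu> R by (auto simp: \<nu>_def r_def w intro!: add_pos_nonneg)
  have sh: "sigma_hat P y = r / sqrt \<nu>"
    using pos by (simp add: sigma_hat_def \<nu>_def[symmetric] r_def[symmetric] real_sqrt_divide)
  have tau: "tau_stat P \<eta> \<theta> y = sqrt \<nu> * u / r"
    by (simp add: tau_stat_def sh u_def)
  have wr: "w = r\<^sup>2 + u\<^sup>2" by (simp add: w r_def u_def)
  \<comment> \<open>Because \<open>w = r\<^sup>2 + u\<^sup>2\<close>, the square root in the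
    truncation set, taken at the value of \<open>tau_stat\<close>, is exactly the multiplier of the
    selection inequality.\<close>
  have "\<nu> + (sqrt \<nu> * u / r)\<^sup>2 = \<nu> * w / r\<^sup>2"
    using pos by (simp add: power_divide power_mult_distrib wr field_simps)
  then have sq: "sqrt (\<nu> + (sqrt \<nu> * u / r)\<^sup>2) = sqrt \<nu> * sqrt w / r"
    using pos by (simp add: real_sqrt_divide real_sqrt_mult)
  \<comment> \<open>By \<open>C ** P = C\<close>, only \<open>P *v y\<close> matters; its coordinate
    along \<eta> is split as \<open>u + \<theta>\<close>.\<close>
  have Cy: "C *v y = u *\<^sub>R (C *v \<eta>) + C *v (\<theta> *\<^sub>R \<eta> + v)"
  proof -
    have "C *v y = C *v (P *v y)" using CP by (simp add: matrix_vector_mul_assoc)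
    also have "\<dots> = C *v (u *\<^sub>R \<eta> + (\<theta> *\<^sub>R \<eta> + v))"
      unfolding Py u_def by (simp add: algebra_simps)
    finally show ?thesis by (simp add: matrix_vector_right_distrib matrix_vector_mult_scaleR)
  qed
  have "(C *v y) $ i \<le> sigma_hat P y * b $ i \<longleftrightarrow>
     sqrt \<nu> * u / r * sqrt w * (C *v \<eta>) $ i + (C *v (\<theta> *\<^sub>R \<eta> + v)) $ i * (sqrt \<nu> * sqrt w / r)
       \<le> sqrt w * b $ i" for i
  proof -
    have "(C *v y) $ i \<le> sigma_hat P y * b $ i \<longleftrightarrow>
      (sqrt \<nu> * sqrt w / r) * ((C *v y) $ i) \<le> (sqrt \<nu> * sqrt w / r) * (r / sqrt \<nu> * b $ i)"
      unfolding sh using pos by (intro mult_le_cancel_left_pos[symmetric]) simp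
    also have "(sqrt \<nu> * sqrt w / r) * (r / sqrt \<nu> * b $ i) = sqrt w * b $ i"
      using pos by simp
    also have "(sqrt \<nu> * sqrt w / r) * ((C *v y) $ i) =
      sqrt \<nu> * u / r * sqrt w * (C *v \<eta>) $ i + (C *v (\<theta> *\<^sub>R \<eta> + v)) $ i * (sqrt \<nu> * sqrt w / r)"
      unfolding Cy by (simp add: algebra_simps)
    finally show ?thesis .
  qed
  then show ?thesis
    by (simp add: selection_event_def less_eq_vec_def truncation_set_def tau sq \<nu>_def[symmetric])
qed

lemma continuous_on_matrix_vector_mult_right [continuous_intros]:
  fixes C :: "real^'n^'m"
  assumes "continuous_on A f"
  shows "continuous_on A (\<lambda>x. C *v f x)"
  using assms by (intro bounded_linear.continuous_on[OF matrix_vector_mul_bounded_linear])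

text \<open>\<open>fst p\<close> stands for a value of the conditioning pair; its second entry minus
  the squared norm of the first recovers the parameter \<open>w\<close>. The set is closed in all
  variables jointly, as \<open>sqrt\<close> is continuous on the whole line, negative arguments
  included.\<close>

lemma truncation_set_measurable:
  fixes \<eta> :: "real^'n"
  shows "{p. snd p \<in> truncation_set \<eta> C b P (snd (fst p) - (norm (fst (fst p)))\<^sup>2) (fst (fst p)) \<theta>} \<in>
    sets (borel \<Otimes>\<^sub>M borel)"
proof -
  have "closed {p :: ((real^'n) \<times> real) \<times> real.
    snd p \<in> truncation_set \<eta> C b P (snd (fst p) - (norm (fst (fst p)))\<^sup>2) (fst (fst p)) \<theta>}"
    unfolding truncation_set_def INT_iff ball_UNIV mem_Collect_eq
    by (intro closed_Collect_all closed_Collect_le continuous_intros)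
  then show ?thesis unfolding borel_prod by (rule borel_closed)
qed

section \<open>The conditional law of the studentised coordinate under selection\<close>

theorem theorem4:
  fixes M :: "'a measure" and y :: "'a \<Rightarrow> real^'n"
    and P :: "real^'n^'n" and C :: "real^'n^'m" and b :: "real^'m"
    and \<mu> \<eta> :: "real^'n" and \<sigma> \<theta> :: real
  assumes "orthogonal_projection_matrix P"
    and "resid_df P \<ge> 1"
    and "C ** P = C"
    and "P *v \<mu> = \<mu>"
    and "\<sigma> > 0"
    and "P *v \<eta> = \<eta>"
    and "norm \<eta> = 1"
    and "\<eta> \<bullet> \<mu> = \<theta>"
    and "measure (isotropic_normal \<mu> \<sigma>) (selection_event C b P) > 0"
    and "prob_space M"
    and "y \<in> borel_measurable M"
    and "distr M borel y = selected_normal C b P \<mu> \<sigma>"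
  shows "is_conditional_law M
           (\<lambda>\<omega>. tau_stat P \<eta> \<theta> (y \<omega>))
           (\<lambda>\<omega>. ((P - outer_product \<eta> \<eta>) *v (y \<omega> - \<theta> *\<^sub>R \<eta>), (norm (y \<omega> - \<theta> *\<^sub>R \<eta>))\<^sup>2))
           (\<lambda>\<omega>. truncated_student_law (resid_df P)
              (truncation_set \<eta> C b P
                 ((norm ((mat 1 - P) *v y \<omega>))\<^sup>2 + (\<eta> \<bullet> y \<omega> - \<theta>)\<^sup>2)
                 ((P - outer_product \<eta> \<eta>) *v y \<omega>)
                 \<theta>))"
proof -
  define R where "R = mat 1 - P"
  define \<nu> where "\<nu> = resid_df P"
  define Q where "Q z = z - R *v z - (\<eta> \<bullet> z) *\<^sub>R \<eta>" for z
  define S where "S y = (Q (y - \<theta> *\<^sub>R \<eta>), (norm (y - \<theta> *\<^sub>R \<eta>))\<^sup>2)" for y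
  \<comment> \<open>\<open>T z\<close> is the value of \<open>S\<close> after the decomposition has
    put \<open>(norm (R *v z))\<^sup>2\<close> in place of
    \<open>(norm (R *v z))\<^sup>2 + (\<eta> \<bullet> z)\<^sup>2\<close>.\<close>
  define T where "T z = (Q z, (norm (Q z))\<^sup>2 + (norm (R *v z))\<^sup>2)" for z
  define m where "m = \<mu> - \<theta> *\<^sub>R \<eta>"
  \<comment> \<open>The normal density in terms of \<open>S\<close>: the distance from
    \<open>y\<close> to \<mu> is that from \<open>z = y - \<theta> *\<^sub>R \<eta>\<close> to
    \<open>m\<close>, and \<open>m \<bullet> z = m \<bullet> Q z\<close> since \<open>m\<close> is
    orthogonal to \<eta> and to the range of \<open>R\<close>.\<close>
  define g :: "(real^'n) \<times> real \<Rightarrow> real" where "g = (\<lambda>s. (1 / sqrt (2 * pi * \<sigma>\<^sup>2)) ^ CARD('n) *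
    exp (- ((snd s - 2 * (m \<bullet> fst s) + (norm m)\<^sup>2) / (2 * \<sigma>\<^sup>2))))"
  define G where "G s = truncation_set \<eta> C b P (snd s - (norm (fst s))\<^sup>2) (fst s) \<theta>" for s
  define \<phi> :: "real \<Rightarrow> ennreal" where "\<phi> = indicator {0..1}"
  define A where "A = selection_event C b P"
  define N where "N = isotropic_normal \<mu> \<sigma>"
  define c where "c = Gamma ((\<nu> + 1) / 2) / (sqrt (\<nu> * pi) * Gamma (\<nu> / 2))"
  define w where "w z = \<phi> (\<eta> \<bullet> z) * ennreal (norm (R *v z) / sqrt \<nu>)" for z
  \<comment> \<open>The law of \<open>S\<close> will have density
    \<open>emeasure (student_law \<nu>) (G s)\<close> with respect to \<Lambda>. The constants
    account for conditioning on \<open>A\<close> and for the normalising constant \<open>c\<close>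
    inside \<open>student_law \<nu>\<close>.\<close>
  define \<Lambda> where "\<Lambda> = distr (density lborel
    (\<lambda>z. w z * (ennreal (g (T z)) * (inverse (emeasure N A) * ennreal (1 / c))))) borel T"
  note \<sigma> = \<open>\<sigma> > 0\<close>
  have \<nu>: "\<nu> \<ge> 1" using assms(2) by (simp add: \<nu>_def)
  have tr: "trace R = \<nu>" by (simp add: R_def \<nu>_def resid_df_def)
  have c: "c > 0" using \<nu> by (simp add: c_def)
  have PP: "P ** P = P" and PT: "transpose P = P"
    using assms(1) by (auto simp: orthogonal_projection_matrix_def)
  have Rv: "R *v z = z - P *v z" for z
    by (simp add: R_def matrix_vector_mult_diff_rdistrib)
  have PPv: "P *v (P *v z) = P *v z" for z
    using PP by (simp add: matrix_vector_mul_assoc)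
  have R: "orthogonal_projection_matrix R"
    unfolding orthogonal_projection_matrix_def
  proof
    show "R ** R = R"
      by (simp add: matrix_eq matrix_vector_mul_assoc[symmetric] Rv matrix_vector_mult_diff_distrib PPv)
    show "transpose R = R"
      using PT by (auto simp: R_def transpose_def vec_eq_iff mat_def)
  qed
  have R\<eta>: "R *v \<eta> = 0" and Rm: "R *v m = 0"
    using assms(4,6) by (simp_all add: Rv m_def matrix_vector_mult_diff_distrib matrix_vector_mult_scaleR)
  have \<eta>\<eta>: "\<eta> \<bullet> \<eta> = 1" using assms(7) by (simp add: norm_eq_1)
  have \<eta>m: "\<eta> \<bullet> m = 0" using assms(8) by (simp add: m_def inner_diff_right \<eta>\<eta>)
  note RR = orthogonal_projection_matrix_vector_mult(1)[OF R]
    and sym = orthogonal_projection_matrix_vector_mult(2)[OF R]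
  have \<eta>R: "\<eta> \<bullet> (R *v z) = 0" for z by (simp add: sym[symmetric] R\<eta>)
  have mR: "m \<bullet> (R *v z) = 0" for z by (simp add: sym[symmetric] Rm)
  have mQ: "m \<bullet> Q z = m \<bullet> z" for z
    using \<eta>m by (simp add: Q_def inner_diff_right mR inner_commute[of m \<eta>])
  \<comment> \<open>The three components are mutually orthogonal. Subtracting
    \<open>(norm (Q z))\<^sup>2\<close> yields the parameter \<open>w\<close> of the truncation
    set.\<close>
  have Pyth: "(norm z)\<^sup>2 = (norm (Q z))\<^sup>2 + ((norm (R *v z))\<^sup>2 + (\<eta> \<bullet> z)\<^sup>2)" for z
  proof -
    have "z \<bullet> (R *v z) = (R *v z) \<bullet> (R *v z)" "(R *v z) \<bullet> z = (R *v z) \<bullet> (R *v z)"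
        "(R *v z) \<bullet> \<eta> = 0" "z \<bullet> \<eta> = \<eta> \<bullet> z"
      using \<eta>R[of z] by (simp_all add: sym RR inner_commute)
    then show ?thesis
      unfolding Q_def power2_norm_eq_inner
      by (simp add: inner_diff_left inner_diff_right \<eta>\<eta> \<eta>R power2_eq_square)
  qed
  have Rz: "R *v (y - \<theta> *\<^sub>R \<eta>) = R *v y" for y
    by (simp add: matrix_vector_mult_diff_distrib matrix_vector_mult_scaleR R\<eta>)
  have \<eta>z: "\<eta> \<bullet> (y - \<theta> *\<^sub>R \<eta>) = \<eta> \<bullet> y - \<theta>" for y by (simp add: inner_diff_right \<eta>\<eta>)
  have Qz: "Q (y - \<theta> *\<^sub>R \<eta>) = Q y" for y
    by (simp add: Q_def Rz \<eta>z) (simp add: algebra_simps)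
  have outer: "(P - outer_product \<eta> \<eta>) *v z = Q z" for z
  proof -
    have "outer_product \<eta> \<eta> *v z = (\<eta> \<bullet> z) *\<^sub>R \<eta>"
      by (simp add: vec_eq_iff outer_product_def matrix_vector_mult_def inner_vec_def
          sum_distrib_left mult_ac)
    then show ?thesis by (simp add: matrix_vector_mult_diff_rdistrib Q_def Rv)
  qed
  have Py: "P *v y = (\<eta> \<bullet> y) *\<^sub>R \<eta> + Q y" for y by (simp add: Q_def Rv)
  have [measurable]: "(\<lambda>z. R *v z) \<in> borel \<rightarrow>\<^sub>M borel"
    by (intro borel_measurable_continuous_onI) (auto intro!: continuous_intros)
  have [measurable]: "Q \<in> borel \<rightarrow>\<^sub>M borel" unfolding Q_def by measurable
  have [measurable]: "S \<in> borel \<rightarrow>\<^sub>M borel" unfolding S_def borel_prod[symmetric] by measurable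
  have [measurable]: "T \<in> borel \<rightarrow>\<^sub>M borel" unfolding T_def borel_prod[symmetric] by measurable
  have [measurable]: "g \<in> borel_measurable borel"
    unfolding g_def borel_prod[symmetric] by measurable
  have [measurable]: "\<phi> \<in> borel_measurable borel" by (simp add: \<phi>_def)
  have [measurable]: "w \<in> borel_measurable borel" unfolding w_def by measurable
  have [measurable]: "tau_stat P \<eta> \<theta> \<in> borel_measurable borel"
    unfolding tau_stat_def sigma_hat_def R_def[symmetric] by measurable
  have A [measurable]: "A \<in> sets borel" unfolding A_def by (rule selection_event_measurable)
  have G: "{p. snd p \<in> G (fst p)} \<in> sets (borel \<Otimes>\<^sub>M borel)"
    unfolding G_def by (rule truncation_set_measurable)
  have Gpred [measurable]: "Measurable.pred (borel \<Otimes>\<^sub>M borel) (\<lambda>p. snd p \<in> G (fst p))"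
    using G by (simp add: pred_def space_pair_measure)
  have N: "N = density lborel (\<lambda>y. ennreal (g (S y)))"
  proof -
    have "(norm (y - \<mu>))\<^sup>2 = snd (S y) - 2 * (m \<bullet> fst (S y)) + (norm m)\<^sup>2" for y
    proof -
      have "y - \<mu> = (y - \<theta> *\<^sub>R \<eta>) - m" by (simp add: m_def)
      then have "(norm (y - \<mu>))\<^sup>2 = (norm (y - \<theta> *\<^sub>R \<eta>))\<^sup>2 - 2 * (m \<bullet> (y - \<theta> *\<^sub>R \<eta>)) + (norm m)\<^sup>2"
        by (simp only: power2_norm_eq_inner inner_diff_left[of _ m] inner_diff_right[of _ _ m]
            inner_commute[of "y - \<theta> *\<^sub>R \<eta>" m])
      then show ?thesis by (simp only: S_def mQ fst_conv snd_conv)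
    qed
    then show ?thesis by (simp add: N_def isotropic_normal_eq_density_norm g_def)
  qed
  have AE_event: "AE z in lborel. z + \<theta> *\<^sub>R \<eta> \<in> A \<longleftrightarrow>
      sqrt \<nu> * (\<eta> \<bullet> z) / norm (R *v z) \<in> G (S (z + \<theta> *\<^sub>R \<eta>))"
  proof -
    have "R \<noteq> 0" using tr \<nu> by (auto simp: trace_def)
    from AE_lborel_matrix_vector_mult_nonzero[OF this] show ?thesis
    proof eventually_elim
      fix z assume z: "R *v z \<noteq> 0"
      define y where "y = z + \<theta> *\<^sub>R \<eta>"
      have zy: "z = y - \<theta> *\<^sub>R \<eta>" by (simp add: y_def)
      have "tau_stat P \<eta> \<theta> y = sqrt \<nu> * (\<eta> \<bullet> z) / norm (R *v z)"
        using \<nu> by (simp add: tau_stat_def sigma_hat_def R_def[symmetric] \<nu>_def[symmetric] zy Rz \<eta>z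
            real_sqrt_divide)
      moreover have "snd (S y) - (norm (fst (S y)))\<^sup>2 = (norm (R *v y))\<^sup>2 + (\<eta> \<bullet> y - \<theta>)\<^sup>2"
        using Pyth[of z] by (simp add: S_def zy Rz \<eta>z)
      ultimately show "z + \<theta> *\<^sub>R \<eta> \<in> A \<longleftrightarrow>
          sqrt \<nu> * (\<eta> \<bullet> z) / norm (R *v z) \<in> G (S (z + \<theta> *\<^sub>R \<eta>))"
        using selection_event_iff_truncation_set[OF assms(3), of y \<eta> "Q y" _ \<theta> b] \<nu> z Py
        by (simp add: A_def G_def y_def[symmetric] R_def[symmetric] \<nu>_def[symmetric] S_def Qz)
          (simp add: zy Rz)
    qed
  qed
  have law: "(\<integral>\<^sup>+\<omega>. h (S (y \<omega>), tau_stat P \<eta> \<theta> (y \<omega>)) \<partial>M) =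
      (\<integral>\<^sup>+s. (\<integral>\<^sup>+t. indicator (G s) t * h (s, t) \<partial>student_law \<nu>) \<partial>\<Lambda>)"
    if [measurable]: "h \<in> borel_measurable (borel \<Otimes>\<^sub>M borel)" for h
  proof -
    \<comment> \<open>The whole integrand in the argument order of the decomposition;
      \<open>(q, (norm q)\<^sup>2 + r)\<close> rebuilds the value of \<open>S\<close> from its
      orthogonal pieces.\<close>
    define H :: "real \<times> (real^'n) \<times> real \<Rightarrow> ennreal" where
      "H = (\<lambda>(t, q, r). ennreal (g (q, (norm q)\<^sup>2 + r)) * (indicator (G (q, (norm q)\<^sup>2 + r)) t *
         h ((q, (norm q)\<^sup>2 + r), t)))"
    \<comment> \<open>Here the set varies with the point, so its indicator is measurable through the
      joint measurability of \<open>G\<close>.\<close>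
    have ind [measurable]: "(\<lambda>x. indicator (G (a x)) (b x) :: ennreal) \<in> borel_measurable L"
      if "a \<in> L \<rightarrow>\<^sub>M borel" "b \<in> L \<rightarrow>\<^sub>M borel" for a b and L :: "'z measure"
    proof -
      have "Measurable.pred L (\<lambda>x. b x \<in> G (a x))"
        using measurable_compose[OF measurable_Pair[OF that] Gpred] by simp
      then show ?thesis by (simp add: borel_measurable_indicator')
    qed
    have [measurable]: "H \<in> borel_measurable borel"
      unfolding H_def borel_prod[symmetric] case_prod_beta by measurable
    interpret \<kappa>: finite_measure "student_law \<nu>" by (rule finite_measure_student_law[OF \<nu>])
    have [measurable_cong]: "sets (student_law \<nu>) = sets borel" by (simp add: student_law_def)
    have [measurable]: "(\<lambda>s. \<integral>\<^sup>+t. indicator (G s) t * h (s, t) \<partial>student_law \<nu>) \<in> borel_measurable borel"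
      by measurable
    let ?\<kappa> = "\<lambda>t. (1 + t\<^sup>2 / \<nu>) powr (- ((\<nu> + 1) / 2))"
    have "(\<integral>\<^sup>+\<omega>. h (S (y \<omega>), tau_stat P \<eta> \<theta> (y \<omega>)) \<partial>M) =
        (\<integral>\<^sup>+y. h (S y, tau_stat P \<eta> \<theta> y) \<partial>uniform_measure N A)"
      unfolding N_def A_def selected_normal_def[symmetric] assms(12)[symmetric]
      using assms(11) by (subst nn_integral_distr) simp_all
    also have "\<dots> = (\<integral>\<^sup>+y. ennreal (g (S y)) * (indicator A y * h (S y, tau_stat P \<eta> \<theta> y)) \<partial>lborel)
        * inverse (emeasure N A)"
      unfolding N
      by (subst nn_integral_uniform_measure) (simp_all add: nn_integral_density divide_ennreal_def mult_ac)
    also have "(\<integral>\<^sup>+y. ennreal (g (S y)) * (indicator A y * h (S y, tau_stat P \<eta> \<theta> y)) \<partial>lborel) =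
      (\<integral>\<^sup>+z. ennreal (g (S (z + \<theta> *\<^sub>R \<eta>))) * (indicator A (z + \<theta> *\<^sub>R \<eta>) *
         h (S (z + \<theta> *\<^sub>R \<eta>), tau_stat P \<eta> \<theta> (z + \<theta> *\<^sub>R \<eta>))) \<partial>lborel)"
      by (subst nn_integral_lborel_add[of _ "\<theta> *\<^sub>R \<eta>", symmetric]) (simp_all add: add.commute)
    also have "\<dots> = (\<integral>\<^sup>+z. H (sqrt \<nu> * (\<eta> \<bullet> z) / norm (R *v z), Q z,
        (norm (R *v z))\<^sup>2 + (\<eta> \<bullet> z)\<^sup>2) \<partial>lborel)"
    proof (rule nn_integral_cong_AE, use AE_event in eventually_elim)
      fix z assume ev: "z + \<theta> *\<^sub>R \<eta> \<in> A \<longleftrightarrow>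
          sqrt \<nu> * (\<eta> \<bullet> z) / norm (R *v z) \<in> G (S (z + \<theta> *\<^sub>R \<eta>))"
      have Sz: "S (z + \<theta> *\<^sub>R \<eta>) = (Q z, (norm (Q z))\<^sup>2 + ((norm (R *v z))\<^sup>2 + (\<eta> \<bullet> z)\<^sup>2))"
        using Pyth[of z] by (simp add: S_def)
      have "tau_stat P \<eta> \<theta> (z + \<theta> *\<^sub>R \<eta>) = sqrt \<nu> * (\<eta> \<bullet> z) / norm (R *v z)"
        using \<nu> Rz[of "z + \<theta> *\<^sub>R \<eta>"] \<eta>z[of "z + \<theta> *\<^sub>R \<eta>"]
        by (simp add: tau_stat_def sigma_hat_def R_def[symmetric] \<nu>_def[symmetric] real_sqrt_divide)
      then show "ennreal (g (S (z + \<theta> *\<^sub>R \<eta>))) * (indicator A (z + \<theta> *\<^sub>R \<eta>) *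
         h (S (z + \<theta> *\<^sub>R \<eta>), tau_stat P \<eta> \<theta> (z + \<theta> *\<^sub>R \<eta>))) =
         H (sqrt \<nu> * (\<eta> \<bullet> z) / norm (R *v z), Q z, (norm (R *v z))\<^sup>2 + (\<eta> \<bullet> z)\<^sup>2)"
        using ev by (simp add: H_def Sz indicator_def)
    qed
    \<comment> \<open>From here on \<open>S\<close> is replaced by \<open>T z\<close>, which is
      constant in \<open>t\<close>, so \<open>g (T z)\<close> leaves the inner integral.\<close>
    also have "\<dots> = (\<integral>\<^sup>+z. w z * (\<integral>\<^sup>+t. ennreal (?\<kappa> t) * H (t, Q z, (norm (R *v z))\<^sup>2) \<partial>lborel) \<partial>lborel)"
      using nn_integral_student_decomposition[OF R _ assms(7) R\<eta>, of \<phi> H] \<nu>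
      by (simp add: tr Q_def w_def \<phi>_def)
    also have "\<dots> * inverse (emeasure N A) =
      (\<integral>\<^sup>+z. w z * (\<integral>\<^sup>+t. ennreal (?\<kappa> t) * H (t, Q z, (norm (R *v z))\<^sup>2) \<partial>lborel) * inverse (emeasure N A) \<partial>lborel)"
      by (rule nn_integral_multc[symmetric]) simp
    also have "\<dots> = (\<integral>\<^sup>+z. w z * (ennreal (g (T z)) * (inverse (emeasure N A) * ennreal (1 / c))) *
        (\<integral>\<^sup>+t. indicator (G (T z)) t * h (T z, t) \<partial>student_law \<nu>) \<partial>lborel)"
    proof (rule nn_integral_cong)
      fix z
      let ?I = "\<integral>\<^sup>+t. ennreal (?\<kappa> t) * (indicator (G (T z)) t * h (T z, t)) \<partial>lborel"
      have "(\<integral>\<^sup>+t. indicator (G (T z)) t * h (T z, t) \<partial>student_law \<nu>) =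
          (\<integral>\<^sup>+t. ennreal (c * ?\<kappa> t) * (indicator (G (T z)) t * h (T z, t)) \<partial>lborel)"
        unfolding student_law_def student_density_def c_def[symmetric]
        by (rule nn_integral_density) measurable
      also have "\<dots> = ennreal c * ?I"
        using c by (simp add: ennreal_mult mult.assoc nn_integral_cmult)
      finally have 1: "(\<integral>\<^sup>+t. indicator (G (T z)) t * h (T z, t) \<partial>student_law \<nu>) = ennreal c * ?I" .
      have "(\<integral>\<^sup>+t. ennreal (?\<kappa> t) * H (t, Q z, (norm (R *v z))\<^sup>2) \<partial>lborel) =
        (\<integral>\<^sup>+t. ennreal (g (T z)) * (ennreal (?\<kappa> t) * (indicator (G (T z)) t * h (T z, t))) \<partial>lborel)"
        by (simp add: H_def T_def mult_ac)
      also have "\<dots> = ennreal (g (T z)) * ?I" by (rule nn_integral_cmult) measurable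
      finally have 2: "(\<integral>\<^sup>+t. ennreal (?\<kappa> t) * H (t, Q z, (norm (R *v z))\<^sup>2) \<partial>lborel) =
        ennreal (g (T z)) * ?I" .
      have 3: "(inverse (emeasure N A) * ennreal (1 / c)) * ennreal c = inverse (emeasure N A)"
        using c by (simp add: mult.assoc ennreal_mult[symmetric])
      show "w z * (\<integral>\<^sup>+t. ennreal (?\<kappa> t) * H (t, Q z, (norm (R *v z))\<^sup>2) \<partial>lborel) * inverse (emeasure N A) =
         w z * (ennreal (g (T z)) * (inverse (emeasure N A) * ennreal (1 / c))) *
         (\<integral>\<^sup>+t. indicator (G (T z)) t * h (T z, t) \<partial>student_law \<nu>)"
        unfolding 1 2 by (subst 3[symmetric]) (simp only: mult_ac)
    qed
    also have "\<dots> = (\<integral>\<^sup>+s. (\<integral>\<^sup>+t. indicator (G s) t * h (s, t) \<partial>student_law \<nu>) \<partial>\<Lambda>)"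
      unfolding \<Lambda>_def by (subst nn_integral_distr) (simp_all add: nn_integral_density)
    finally show ?thesis .
  qed
  have "is_conditional_law M (\<lambda>\<omega>. tau_stat P \<eta> \<theta> (y \<omega>)) (\<lambda>\<omega>. S (y \<omega>))
      (\<lambda>\<omega>. uniform_measure (student_law \<nu>) (G (S (y \<omega>))))"
    using assms(11)
    by (intro is_conditional_law_uniform_measure[OF assms(10) _ _ finite_measure_student_law[OF \<nu>] _ _ G law])
      (auto simp: student_law_def \<Lambda>_def)
  \<comment> \<open>\<open>Q\<close> annihilates \<eta>, so centring does not change
    \<open>Q x\<close>, and \<open>Pyth\<close> identifies the recovered parameter
    \<open>w\<close>.\<close>
  moreover have "G (S x) = truncation_set \<eta> C b P
     ((norm ((mat 1 - P) *v x))\<^sup>2 + (\<eta> \<bullet> x - \<theta>)\<^sup>2) ((P - outer_product \<eta> \<eta>) *v x) \<theta>" for x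
    using Pyth[of "x - \<theta> *\<^sub>R \<eta>"] by (simp add: G_def S_def Qz outer R_def[symmetric] Rz \<eta>z)
  ultimately show ?thesis
    by (simp add: S_def outer truncated_student_law_def \<nu>_def)
qed

end
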